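(* Let $G$ be a directed multi-graph and $r$ a vertex of $G$ such that the support of $G-r$ is a clique (in particular, $G$ can have several arcs between two vertices $u$ and $v$, possibly in opposite directions). Then the flip graph $\mathcal{F}_r(G)$ is empty or has a Hamiltonian path.
   Context: Graphs are finite and loopless. In a directed multi-graph, several parallel arcs with the same tail and head are allowed and are regarded as distinct arcs; arcs in opposite directions between two vertices are also allowed. $G-r$ is obtained from $G$ by deleting the vertex $r$. The support of a directed multi-graph is the undirected simple graph on the same vertex set with an edge between $u$ and $v$ if there is at least one arc from $u$ to $v$ or from $v$ to $u$. A clique is a complete graph. An arborescence of $G$ rooted in $r$ is a spanning tree of $G$ (viewed as a set of arcs) in which all arcs are oriented away from $r$. Two arborescences differ by an arc flip if they are equal on all arcs but one. The flip graph $\mathcal{F}_r(G)$ is the undirected graph whose vertices are the arborescences of $G$ rooted in $r$, two of them being adjacent if they differ by an arc flip. It is empty if it has no vertex. A Hamiltonian path is a path visiting every vertex exactly once (a single-vertex graph has one). *)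

theory Defs
  imports
    "Graph_Theory.Digraph_Component"
    "Graph_Theory.Vertex_Walk"
    "Graph_Theory.Kuratowski"
begin

text \<open>
  Undirected graphs are represented by symmetric digraphs, as in the library: the simple graph
  underlying a directed multigraph is \<^const>\<open>mk_symmetric\<close>, and complete graphs
  are given by \<^const>\<open>complete_digraph\<close>. The empty graph counts as complete.
\<close>

definition clique :: "('a, 'b) pre_digraph \<Rightarrow> bool" where
  "clique H \<longleftrightarrow> (\<exists>n. complete_digraph n H)"

abbreviation support :: "('a, 'b) pre_digraph \<Rightarrow> ('a, 'a \<times> 'a) pre_digraph" where
  "support G \<equiv> with_proj (mk_symmetric G)"

text \<open>
  The library's \<^const>\<open>forest\<close> (hence also \<^const>\<open>tree\<close> and
  \<^const>\<open>spanning_tree\<close>) excludes directed cycles only, so a transitive triangle or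
  two parallel arcs would pass as a tree. Cycles of the underlying undirected multigraph
  are obtained by letting each arc be traversed in both directions: \<open>(e, True)\<close> is
  \<open>e\<close> traversed from tail to head, \<open>(e, False)\<close> is \<open>e\<close> traversed backwards.
\<close>

definition bidirect :: "('a, 'b) pre_digraph \<Rightarrow> ('a, 'b \<times> bool) pre_digraph" where
  "bidirect H = \<lparr> verts = verts H, arcs = arcs H \<times> UNIV,
     tail = (\<lambda>(e, fwd). if fwd then tail H e else head H e),
     head = (\<lambda>(e, fwd). if fwd then head H e else tail H e) \<rparr>"

text \<open>
  Distinctness of the underlying arcs rules out going back and forth along one arc, while
  two parallel or opposite arcs do form a cycle.
\<close>

definition undirected_cycle :: "('a, 'b) pre_digraph \<Rightarrow> ('b \<times> bool) list \<Rightarrow> bool" where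
  "undirected_cycle H p \<longleftrightarrow> pre_digraph.cycle (bidirect H) p \<and> distinct (map fst p)"

definition undirected_tree :: "('a, 'b) pre_digraph \<Rightarrow> bool" where
  "undirected_tree H \<longleftrightarrow> connected H \<and> (\<nexists>p. undirected_cycle H p)"

text \<open>An arc points away from \<open>r\<close> if the path in the tree that starts at \<open>r\<close> and ends
  with this arc traverses it from tail to head.\<close>

definition oriented_away :: "('a, 'b) pre_digraph \<Rightarrow> 'a \<Rightarrow> bool" where
  "oriented_away H r \<longleftrightarrow>
     (\<forall>e\<in>arcs H. \<exists>p. pre_digraph.apath (bidirect H) r (p @ [(e, True)]) (head H e))"

definition arborescence :: "('a, 'b) pre_digraph \<Rightarrow> 'a \<Rightarrow> 'b set \<Rightarrow> bool" where
  "arborescence G r T \<longleftrightarrow> r \<in> verts G \<and>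
     (let H = G\<lparr>arcs := T\<rparr> in spanning H G \<and> undirected_tree H \<and> oriented_away H r)"

definition arc_flip :: "'b set \<Rightarrow> 'b set \<Rightarrow> bool" where
  "arc_flip S T \<longleftrightarrow> (\<exists>e f. e \<in> S - T \<and> f \<in> T - S \<and> S - {e} = T - {f})"

definition flip_graph :: "('a, 'b) pre_digraph \<Rightarrow> 'a \<Rightarrow> 'b set pair_pre_digraph" where
  "flip_graph G r = \<lparr> pverts = {T. arborescence G r T},
     parcs = {(S, T). arborescence G r S \<and> arborescence G r T \<and> arc_flip S T} \<rparr>"

definition hamiltonian_path :: "('a, 'b) pre_digraph \<Rightarrow> 'a list \<Rightarrow> bool" where
  "hamiltonian_path F p \<longleftrightarrow> vpath p F \<and> set p = verts F"

end

theory Submission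
  imports Defs
begin

text \<open>
  Every non-root vertex of an arborescence has exactly one entering arc, and an arc flip replaces
  the arc entering one vertex. Contracting a root arc, or deleting one, preserves the clique
  hypothesis, so one can induct: the arborescences avoiding a root arc \<open>g\<close> and those
  containing it have Hamiltonian paths, and the two paths have to be joined by a flip. Exchanging
  the arc entering the head of \<open>g\<close> for \<open>g\<close> is always possible, so the
  join works if the second path may start anywhere. This is the case if the root has two parallel
  arcs \<open>e\<close>, \<open>e'\<close>, which is the second statement proved in the same
  induction. If \<open>r\<close> has arcs to \<open>v\<close> and \<open>w\<close> and there is an
  arc from \<open>w\<close> to \<open>v\<close>, then contracting \<open>r \<rightarrow> w\<close>
  produces two parallel root arcs to \<open>v\<close>.

  The statement for parallel root arcs to \<open>v\<close> is strengthened: the path also ends in an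
  arborescence containing \<open>e\<close> or \<open>e'\<close>, so that afterwards an arc from
  \<open>v\<close> can replace a root arc. If no such exchange is available, then a further vertex
  \<open>w\<close> with an arc to \<open>v\<close> becomes part of the root, giving three parallel arcs
  to \<open>v\<close>. Grouping the arborescences into cliques by forgetting the arc entering
  \<open>v\<close>, a Hamiltonian path of the quotient lifts to one starting anywhere: walk back to
  the start of the quotient path while sparing one common arc, return along this arc, then
  traverse the rest.
\<close>

section \<open>Paths in flip graphs\<close>

lemma arc_flip_sym: "arc_flip S T \<Longrightarrow> arc_flip T S"
  unfolding arc_flip_def by metis

lemma successively_arc_flip_rev:
  fixes xs :: "'b set list"
  shows "successively arc_flip (rev xs) \<longleftrightarrow> successively arc_flip xs"
proof -
  have "(\<lambda>S T. arc_flip T S) = (arc_flip :: 'b set \<Rightarrow> 'b set \<Rightarrow> bool)" by (intro ext iffI) (rule arc_flip_sym, assumption)+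
  then show ?thesis by (subst successively_rev) (simp only:)
qed

lemma arc_flip_insert: "a \<notin> F \<Longrightarrow> b \<notin> F \<Longrightarrow> a \<noteq> b \<Longrightarrow> arc_flip (insert a F) (insert b F)"
  unfolding arc_flip_def by (rule exI[of _ a], rule exI[of _ b]) auto

lemma arc_flip_insert_same:
  assumes "arc_flip S T" "c \<notin> S" "c \<notin> T"
  shows "arc_flip (insert c S) (insert c T)"
proof -
  obtain a b where ab: "a \<in> S - T" "b \<in> T - S" "S - {a} = T - {b}"
    using assms(1) unfolding arc_flip_def by auto
  then have "insert c S - {a} = insert c T - {b}" using assms by auto
  then show ?thesis unfolding arc_flip_def using ab assms by blast
qed

text \<open>A Hamiltonian path of the flip graph induced on \<open>P\<close>, kept as a nonempty
  list so that \<open>hd\<close> and \<open>last\<close> are its ends; the gluing lemmas keep track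
  of these.\<close>

definition flip_path :: "'b set set \<Rightarrow> 'b set list \<Rightarrow> bool" where
  "flip_path P xs \<longleftrightarrow> xs \<noteq> [] \<and> distinct xs \<and> set xs = P \<and> successively arc_flip xs"

lemma flip_path_singleton: "flip_path {S} [S]"
  by (simp add: flip_path_def)

lemma flip_path_hd: "flip_path P xs \<Longrightarrow> hd xs \<in> P" and flip_path_last: "flip_path P xs \<Longrightarrow> last xs \<in> P"
  by (auto simp: flip_path_def)

lemma flip_path_append:
  assumes "flip_path P xs" "flip_path Q ys" "P \<inter> Q = {}" "arc_flip (last xs) (hd ys)"
  shows "flip_path (P \<union> Q) (xs @ ys)" "hd (xs @ ys) = hd xs" "last (xs @ ys) = last ys"
  using assms by (auto simp: flip_path_def successively_append_iff)

lemma flip_path_rev: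
  assumes "flip_path P xs"
  shows "flip_path P (rev xs)" "hd (rev xs) = last xs" "last (rev xs) = hd xs"
proof -
  show "flip_path P (rev xs)" using assms by (simp add: flip_path_def successively_arc_flip_rev del: successively_rev)
  show "hd (rev xs) = last xs" "last (rev xs) = hd xs" using assms by (auto simp: flip_path_def hd_rev last_rev)
qed

lemma flip_path_map_insert:
  assumes "flip_path P xs" "\<And>S. S \<in> P \<Longrightarrow> g \<notin> S"
  shows "flip_path (insert g ` P) (map (insert g) xs)"
    "hd (map (insert g) xs) = insert g (hd xs)" "last (map (insert g) xs) = insert g (last xs)"
proof -
  have "inj_on (insert g) P" using assms(2) by (intro inj_onI) (metis insert_ident)
  moreover have "successively (\<lambda>x y. arc_flip (insert g x) (insert g y)) xs"
    using assms unfolding flip_path_def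
    by (auto intro!: arc_flip_insert_same elim!: successively_mono)
  ultimately show "flip_path (insert g ` P) (map (insert g) xs)"
    using assms(1) by (auto simp: flip_path_def distinct_map successively_map)
  show "hd (map (insert g) xs) = insert g (hd xs)" "last (map (insert g) xs) = insert g (last xs)"
    using assms(1) by (auto simp: flip_path_def hd_map last_map)
qed

section \<open>Fibers and the lifting of paths through them\<close>

lemma distinct_imp_successively: "distinct xs \<Longrightarrow> successively (\<noteq>) xs"
  by (induction xs rule: induct_list012) auto

text \<open>A common part \<open>F\<close> completed by one varying arc from \<open>A\<close>. As
  long as \<open>A\<close> avoids \<open>F\<close>, any two members differ by a flip, so a fiber is
  a clique of the flip graph.\<close>

definition fiber :: "'b set \<Rightarrow> 'b set \<Rightarrow> 'b set set" where
  "fiber F A = (\<lambda>d. insert d F) ` A"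

text \<open>In a clique every enumeration is a path, so both ends can be prescribed; equal ends
  require a single element.\<close>

lemma flip_path_fiber:
  assumes "finite A" "a \<in> A" "b \<in> A" "a = b \<longrightarrow> A = {a}" "A \<inter> F = {}"
  shows "\<exists>xs. flip_path (fiber F A) xs \<and> hd xs = insert a F \<and> last xs = insert b F"
proof (cases "a = b")
  case True
  then show ?thesis using assms flip_path_singleton[of "insert a F"] by (auto simp: fiber_def intro!: exI[of _ "[insert a F]"])
next
  case False
  obtain ds where ds: "set ds = A - {a, b}" "distinct ds"
    using finite_distinct_list[of "A - {a,b}"] assms(1) by auto
  define l where "l = a # ds @ [b]"
  have l: "distinct l" "set l = A" using ds False assms by (auto simp: l_def)
  have inj: "inj_on (\<lambda>d. insert d F) A" using assms(5) by (auto simp: inj_on_def)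
  have "successively (\<noteq>) l" using l(1) by (rule distinct_imp_successively)
  then have "successively (\<lambda>x y. arc_flip (insert x F) (insert y F)) l"
    by (rule successively_mono) (use assms l in \<open>auto intro!: arc_flip_insert\<close>)
  then have "flip_path (fiber F A) (map (\<lambda>d. insert d F) l)"
    using l inj by (auto simp: flip_path_def fiber_def distinct_map successively_map l_def[THEN arg_cong[where f="\<lambda>x. x = []"]])
  then show ?thesis by (intro exI[of _ "map (\<lambda>d. insert d F) l"]) (auto simp: l_def hd_map last_map)
qed

text \<open>In the application \<open>V\<close> consists of the arcs entering a vertex
  \<open>v\<close>, \<open>D F\<close> of those that complete the forest \<open>F\<close> to an
  arborescence, and \<open>C\<close> of the root arcs to \<open>v\<close>, which complete every
  forest and hence are common to all fibers.\<close>

context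
  fixes V :: "'b set" and D :: "'b set \<Rightarrow> 'b set" and C :: "'b set"
begin

definition fiber_union :: "'b set list \<Rightarrow> 'b set set" where
  "fiber_union Fs = (\<Union>F\<in>set Fs. fiber F (D F))"

definition fibered :: "'b set list \<Rightarrow> bool" where
  "fibered Fs \<longleftrightarrow> distinct Fs \<and> successively arc_flip Fs \<and>
     (\<forall>F\<in>set Fs. F \<inter> V = {} \<and> finite (D F) \<and> C \<subseteq> D F \<and> D F \<subseteq> V)"

text \<open>An element of a fiber determines both of its parts: intersecting with \<open>V\<close>
  recovers the varying arc, removing \<open>V\<close> recovers \<open>F\<close>.\<close>

lemma fiber_disjoint:
  assumes "A \<subseteq> V" "B \<subseteq> V" "F \<inter> V = {}" "F' \<inter> V = {}" "F \<noteq> F' \<or> A \<inter> B = {}"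
  shows "fiber F A \<inter> fiber F' B = {}"
proof (rule ccontr)
  assume "fiber F A \<inter> fiber F' B \<noteq> {}"
  then obtain a b where ab: "a \<in> A" "b \<in> B" "insert a F = insert b F'" unfolding fiber_def by auto
  have "insert a F - V = F" "insert b F' - V = F'" "insert a F \<inter> V = {a}" "insert b F' \<inter> V = {b}"
    using ab assms by auto
  then show False using ab assms(5) by auto
qed

lemma fiber_union_disjoint:
  assumes "fibered (F # Fs)" "A \<subseteq> V"
  shows "fiber F A \<inter> fiber_union Fs = {}"
proof -
  have "fiber F A \<inter> fiber F' (D F') = {}" if "F' \<in> set Fs" for F'
    by (rule fiber_disjoint) (use assms that in \<open>auto simp: fibered_def\<close>)
  then show ?thesis unfolding fiber_union_def by blast
qed

text \<open>Each fiber is traversed completely and left through whichever of \<open>e\<close> and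
  \<open>e'\<close> was not the entry. Being in \<open>C\<close>, this arc also occurs in the next
  fiber, so moving on is a single flip.\<close>

lemma snake:
  assumes "fibered Fs" "Fs \<noteq> []" "c \<in> D (hd Fs)" "e \<in> C" "e' \<in> C" "e \<noteq> e'"
  shows "\<exists>xs. flip_path (fiber_union Fs) xs \<and> hd xs = insert c (hd Fs) \<and>
    last xs \<in> {insert e (last Fs), insert e' (last Fs)}"
  using assms
proof (induction Fs arbitrary: c)
  case (Cons F Fs)
  obtain c' where c': "c' \<in> {e, e'}" "c' \<noteq> c" using Cons.prems by auto
  have D: "finite (D F)" "D F \<inter> F = {}" "c' \<in> D F" "D F \<subseteq> V" "c' \<in> V" "F \<inter> V = {}"
    using Cons.prems c' by (auto simp: fibered_def)
  obtain xs where xs: "flip_path (fiber F (D F)) xs" "hd xs = insert c F" "last xs = insert c' F"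
    using flip_path_fiber[of "D F" c c' F] D c' Cons.prems by auto
  show ?case
  proof (cases "Fs = []")
    case True
    then show ?thesis using xs c' by (auto simp: fiber_union_def)
  next
    case False
    have fib: "fibered Fs" using Cons.prems(1) by (auto simp: fibered_def successively_Cons)
    have F': "hd Fs \<inter> V = {}" "c' \<in> D (hd Fs)" "arc_flip F (hd Fs)"
      using Cons.prems c' False by (auto simp: fibered_def successively_Cons)
    obtain ys where ys: "flip_path (fiber_union Fs) ys" "hd ys = insert c' (hd Fs)"
      "last ys \<in> {insert e (last Fs), insert e' (last Fs)}"
      using Cons.IH[OF fib False F'(2)] Cons.prems by auto
    have "arc_flip (last xs) (hd ys)"
      unfolding xs ys by (rule arc_flip_insert_same) (use F' D in auto)
    note app = flip_path_append[OF xs(1) ys(1) fiber_union_disjoint[OF Cons.prems(1) D(4)] this]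
    have "fiber F (D F) \<union> fiber_union Fs = fiber_union (F # Fs)" "last (F # Fs) = last Fs"
      using False by (auto simp: fiber_union_def)
    then show ?thesis using app ys(3) xs(2) by (metis list.sel(1))
  qed
qed simp

text \<open>
  The way there covers each fiber except for the element given by \<open>s\<close>, the way back
  uses these. The last assumption provides the exit from a fiber entered at \<open>a\<close>.
\<close>

lemma there_and_back:
  assumes "fibered Fs" "Fs \<noteq> []" "s \<in> C" "a \<in> D (hd Fs)" "a \<noteq> s"
    and "\<And>F a. F \<in> set Fs \<Longrightarrow> a \<in> D F - {s} \<Longrightarrow> \<exists>c\<in>C - {s}. c = a \<longrightarrow> D F - {s} = {a}"
  shows "\<exists>xs. flip_path (fiber_union Fs) xs \<and> hd xs = insert a (hd Fs) \<and> last xs = insert s (hd Fs)"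
  using assms
proof (induction Fs arbitrary: a)
  case (Cons F Fs)
  obtain c where c: "c \<in> C - {s}" "c = a \<longrightarrow> D F - {s} = {a}" using Cons.prems(4,5) Cons.prems(6)[of F a] by auto
  have D: "finite (D F)" "D F \<inter> F = {}" "C \<subseteq> D F" "D F \<subseteq> V" "F \<inter> V = {}" "s \<in> D F"
    using Cons.prems by (auto simp: fibered_def)
  obtain xs where xs: "flip_path (fiber F (D F - {s})) xs" "hd xs = insert a F" "last xs = insert c F"
    using flip_path_fiber[of "D F - {s}" a c F] D c Cons.prems by auto
  have all: "fiber F (D F) = fiber F (D F - {s}) \<union> {insert s F}" using D by (auto simp: fiber_def)
  have s1: "insert s F \<notin> fiber F (D F - {s})"
    using fiber_disjoint[of "D F - {s}" "{s}" F F] D by (auto simp: fiber_def)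
  show ?case
  proof (cases "Fs = []")
    case True
    \<comment> \<open>In the farthest fiber the path turns around by exchanging the exit arc for the
      spared \<open>s\<close>.\<close>
    have "arc_flip (last xs) (hd [insert s F])" unfolding xs using D c by (auto intro!: arc_flip_insert)
    from flip_path_append[OF xs(1) flip_path_singleton _ this] s1 xs(2) True
    show ?thesis by (auto simp: fiber_union_def all)
  next
    case False
    have fib: "fibered Fs" using Cons.prems(1) by (auto simp: fibered_def successively_Cons)
    have F': "hd Fs \<inter> V = {}" "c \<in> D (hd Fs)" "arc_flip F (hd Fs)" "s \<in> D (hd Fs)" "c \<in> V" "s \<in> V"
      using Cons.prems c False D by (auto simp: fibered_def successively_Cons)
    have "\<exists>ys. flip_path (fiber_union Fs) ys \<and> hd ys = insert c (hd Fs) \<and> last ys = insert s (hd Fs)"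
      by (rule Cons.IH[OF fib False]) (use F' c Cons.prems in auto)
    then obtain ys where ys: "flip_path (fiber_union Fs) ys" "hd ys = insert c (hd Fs)" "last ys = insert s (hd Fs)"
      by auto
    have 1: "arc_flip (last xs) (hd ys)"
      unfolding xs ys by (rule arc_flip_insert_same) (use F' D in auto)
    have "fiber F (D F - {s}) \<inter> fiber_union Fs = {}"
      by (rule fiber_union_disjoint[OF Cons.prems(1)]) (use D in auto)
    note 2 = flip_path_append[OF xs(1) ys(1) this 1]
    have "arc_flip (last (xs @ ys)) (hd [insert s F])"
      unfolding 2 ys list.sel
      by (rule arc_flip_insert_same[OF arc_flip_sym]) (use F' D in auto)
    moreover have "insert s F \<notin> fiber_union Fs"
      using fiber_union_disjoint[OF Cons.prems(1), of "{s}"] F' by (auto simp: fiber_def)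
    ultimately have "flip_path (fiber F (D F - {s}) \<union> fiber_union Fs \<union> {insert s F}) ((xs @ ys) @ [insert s F])"
      by (intro flip_path_append(1)[OF 2(1) flip_path_singleton]) (use s1 in auto)
    moreover have "fiber F (D F - {s}) \<union> fiber_union Fs \<union> {insert s F} = fiber_union (F # Fs)"
      by (auto simp: fiber_union_def all)
    ultimately have "flip_path (fiber_union (F # Fs)) ((xs @ ys) @ [insert s F])" by simp
    moreover have "hd ((xs @ ys) @ [insert s F]) = insert a F"
      using 2(2) xs(1,2) by (simp add: flip_path_def)
    ultimately show ?thesis by (metis last_snoc list.sel(1))
  qed
qed simp

text \<open>From the fiber of \<open>F\<close> the path goes to the front of \<open>Fs\<close> and
  back by \<open>there_and_back\<close>, then covers the rest by \<open>snake\<close>, which is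
  entered through the spared arc.\<close>

lemma sweep:
  assumes fib: "fibered Fs" and F: "F \<in> set Fs" "a \<in> D F" and e: "e \<in> C" "e' \<in> C" "e \<noteq> e'"
    and C: "(\<exists>f\<in>C. f \<noteq> e \<and> f \<noteq> e') \<or> (\<forall>F\<in>set Fs. D F = C)"
  shows "\<exists>xs. flip_path (fiber_union Fs) xs \<and> hd xs = insert a F \<and>
    last xs \<in> {insert e (last Fs), insert e' (last Fs)}"
proof -
  obtain Ls Rs where Fs: "Fs = Ls @ F # Rs" using F(1) by (meson split_list)
  \<comment> \<open>The spared arc must differ from the start \<open>a\<close>; of two candidates
    one does.\<close>
  obtain s where s: "s \<in> {e, e'}" "s \<noteq> a" using e by auto
  have fl: "fibered (F # rev Ls)" "fibered Rs" "F # rev Ls \<noteq> []"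
  proof -
    have "successively arc_flip (Ls @ [F])"
      using fib unfolding Fs fibered_def by (auto simp: successively_append_iff)
    then have "successively arc_flip (rev (Ls @ [F]))" by (simp only: successively_arc_flip_rev)
    then show "fibered (F # rev Ls)" using fib unfolding Fs fibered_def by auto
    show "fibered Rs" using fib unfolding Fs fibered_def
      by (auto simp: successively_append_iff successively_Cons)
  qed simp
  \<comment> \<open>With three arcs in \<open>C\<close>, two remain besides \<open>s\<close>, and
    one of them is not \<open>b\<close>. If \<open>D F' = C\<close>, then \<open>b\<close> itself is
    in \<open>C\<close>: either it is all that remains besides \<open>s\<close>, or there is another
    exit.\<close>
  have "\<exists>c\<in>C - {s}. c = b \<longrightarrow> D F' - {s} = {b}" if "F' \<in> set (F # rev Ls)" "b \<in> D F' - {s}" for F' b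
  proof (cases "\<exists>f\<in>C. f \<noteq> e \<and> f \<noteq> e'")
    case True
    then show ?thesis using e s by (metis Diff_iff empty_iff insert_iff)
  next
    case False
    moreover have "F' \<in> set Fs" using that(1) Fs by auto
    ultimately have "D F' = C" using C by blast
    then show ?thesis using that(2) by blast
  qed
  from there_and_back[OF fl(1,3) _ _ s(2)[symmetric] this]
  obtain xs where xs: "flip_path (fiber_union (F # rev Ls)) xs" "hd xs = insert a F" "last xs = insert s F"
    using s e F(2) by auto
  show ?thesis
  proof (cases "Rs = []")
    case True
    then show ?thesis using xs s by (auto simp: Fs fiber_union_def)
  next
    case False
    have all: "\<forall>F\<in>set Fs. F \<inter> V = {} \<and> C \<subseteq> D F \<and> D F \<subseteq> V"
      and "successively arc_flip Fs"
      using fib by (auto simp: fibered_def)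
    then have "arc_flip F (hd Rs)"
      using False by (simp add: Fs successively_append_iff successively_Cons)
    moreover have "F \<in> set Fs" "hd Rs \<in> set Fs" "s \<in> C" using False s e by (auto simp: Fs)
    ultimately have sD: "s \<in> D (hd Rs)" "arc_flip F (hd Rs)" "s \<notin> F" "s \<notin> hd Rs"
      using all by blast+
    obtain ys where ys: "flip_path (fiber_union Rs) ys" "hd ys = insert s (hd Rs)"
      "last ys \<in> {insert e (last Rs), insert e' (last Rs)}"
      using snake[OF fl(2) False sD(1) e] by auto
    have "fiber G (D G) \<inter> fiber H (D H) = {}" if "G \<in> set (F # rev Ls)" "H \<in> set Rs" for G H
    proof (rule fiber_disjoint)
      show "D G \<subseteq> V" "D H \<subseteq> V" "G \<inter> V = {}" "H \<inter> V = {}" using fib that by (auto simp: Fs fibered_def)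
      show "G \<noteq> H \<or> D G \<inter> D H = {}" using fib that by (auto simp: Fs fibered_def)
    qed
    then have "fiber_union (F # rev Ls) \<inter> fiber_union Rs = {}" unfolding fiber_union_def by blast
    moreover have "arc_flip (last xs) (hd ys)"
      unfolding xs ys using sD by (auto intro: arc_flip_insert_same)
    moreover have "fiber_union Fs = fiber_union (F # rev Ls) \<union> fiber_union Rs" by (auto simp: fiber_union_def Fs)
    ultimately have "flip_path (fiber_union Fs) (xs @ ys)" "hd (xs @ ys) = insert a F" "last (xs @ ys) = last ys"
      using flip_path_append[OF xs(1) ys(1)] xs(2) by simp_all
    moreover have "last Rs = last Fs" using False by (simp add: Fs)
    ultimately show ?thesis using ys(3) by metis
  qed
qed

end

section \<open>Arborescences as sets of entering arcs\<close>

context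
  fixes t h :: "'b \<Rightarrow> 'a"
begin

text \<open>
  \<open>W\<close> is the set of non-root vertices; everything outside of \<open>W\<close> counts as the
  root. Thus contracting a root arc \<open>g\<close> amounts to removing \<open>h g\<close> from
  \<open>W\<close>; arcs that then have their head outside of \<open>W\<close> are ignored.
\<close>

definition arb :: "'a set \<Rightarrow> 'b set \<Rightarrow> bool" where
  "arb W S \<longleftrightarrow> (\<forall>a\<in>S. h a \<in> W) \<and> (\<forall>w\<in>W. \<exists>a\<in>S. h a = w) \<and> inj_on h S \<and>
     (\<forall>X. X \<subseteq> W \<longrightarrow> X \<noteq> {} \<longrightarrow> (\<exists>a\<in>S. h a \<in> X \<and> t a \<notin> X))"

definition arbs :: "'a set \<Rightarrow> 'b set \<Rightarrow> 'b set set" where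
  "arbs W E = {S. S \<subseteq> E \<and> arb W S}"

definition root_arc :: "'a set \<Rightarrow> 'b set \<Rightarrow> 'b \<Rightarrow> bool" where
  "root_arc W E a \<longleftrightarrow> a \<in> E \<and> h a \<in> W \<and> t a \<notin> W"

text \<open>The clique hypothesis in a form that is inherited by smaller \<open>W\<close> and by
  deletion of root arcs: only arcs with both ends in \<open>W\<close> are demanded. Finiteness is
  included because the induction is on \<open>card W + card E\<close>.\<close>

definition semicomplete :: "'a set \<Rightarrow> 'b set \<Rightarrow> bool" where
  "semicomplete W E \<longleftrightarrow> finite W \<and> finite E \<and>
     (\<forall>x\<in>W. \<forall>y\<in>W. x \<noteq> y \<longrightarrow> (\<exists>a\<in>E. t a = x \<and> h a = y \<or> t a = y \<and> h a = x))"

text \<open>The cut form of reachability from the root. For \<open>X = W\<close> it yields a root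
  arc.\<close>

lemma arb_entering: "arb W S \<Longrightarrow> X \<subseteq> W \<Longrightarrow> X \<noteq> {} \<Longrightarrow> \<exists>a\<in>S. h a \<in> X \<and> t a \<notin> X"
  unfolding arb_def by blast

lemma arb_in_arc: "arb W S \<Longrightarrow> w \<in> W \<Longrightarrow> \<exists>a\<in>S. h a = w"
  unfolding arb_def by blast

lemma arb_unique: "arb W S \<Longrightarrow> a \<in> S \<Longrightarrow> b \<in> S \<Longrightarrow> h a = h b \<Longrightarrow> a = b"
  unfolding arb_def inj_on_def by blast

lemma arb_head: "arb W S \<Longrightarrow> a \<in> S \<Longrightarrow> h a \<in> W"
  unfolding arb_def by blast

lemma arb_empty: "arb {} S \<longleftrightarrow> S = {}"
  unfolding arb_def by auto

text \<open>Undoes the contraction of \<open>g\<close>: a set containing the head of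
  \<open>g\<close> is entered by \<open>g\<close> itself, any other set already by an arc of
  \<open>S\<close>.\<close>

lemma arb_insert_root:
  assumes "arb (W - {h g}) S" "h g \<in> W" "t g \<notin> W"
  shows "arb W (insert g S)"
proof -
  have "\<exists>a\<in>insert g S. h a \<in> X \<and> t a \<notin> X" if "X \<subseteq> W" "X \<noteq> {}" for X
  proof (cases "h g \<in> X")
    case True
    then show ?thesis using assms that by auto
  next
    case False
    then have "X \<subseteq> W - {h g}" using that by auto
    then show ?thesis using arb_entering[OF assms(1) _ that(2)] by auto
  qed
  moreover have "inj_on h (insert g S)" using assms(1) unfolding arb_def by auto
  ultimately show ?thesis using assms unfolding arb_def by blast
qed

text \<open>Here \<open>k\<close> starts at a vertex that \<open>b\<close> joins directly to the
  root. A set containing the head of \<open>k\<close> is entered by \<open>k\<close>, or else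
  contains the tail of \<open>k\<close> and is entered by \<open>b\<close>.\<close>

lemma arb_insert_arc:
  assumes "arb (W - {h k}) S" "h k \<in> W" "t k \<noteq> h k" "b \<in> S" "h b = t k" "t b \<notin> W"
  shows "arb W (insert k S)"
proof -
  have "\<exists>a\<in>insert k S. h a \<in> X \<and> t a \<notin> X" if "X \<subseteq> W" "X \<noteq> {}" for X
  proof (cases "h k \<in> X")
    case True
    then show ?thesis using assms that by (cases "t k \<in> X") (metis insertCI subsetD, blast)
  next
    case False
    then have "X \<subseteq> W - {h k}" using that by auto
    then show ?thesis using arb_entering[OF assms(1) _ that(2)] by auto
  qed
  moreover have "inj_on h (insert k S)" using assms(1) unfolding arb_def by auto
  ultimately show ?thesis using assms unfolding arb_def by blast
qed

text \<open>Moving the head of \<open>g\<close> into the root makes the arcs leaving it root arcs,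
  so everything below \<open>g\<close> stays attached.\<close>

lemma arb_remove:
  assumes "arb W S" "g \<in> S"
  shows "arb (W - {h g}) (S - {g})"
proof -
  have head: "h a \<noteq> h g" if "a \<in> S - {g}" for a using arb_unique[OF assms(1)] assms(2) that by auto
  have "\<exists>a\<in>S - {g}. h a \<in> X \<and> t a \<notin> X" if X: "X \<subseteq> W - {h g}" "X \<noteq> {}" for X
  proof -
    have "X \<subseteq> W" using X by auto
    then obtain a where "a \<in> S" "h a \<in> X" "t a \<notin> X" using arb_entering[OF assms(1)] X by blast
    moreover have "a \<noteq> g" using calculation X by auto
    ultimately show ?thesis by auto
  qed
  moreover have "inj_on h (S - {g})" using assms(1) unfolding arb_def by (auto intro: inj_on_diff)
  moreover have "\<exists>a\<in>S - {g}. h a = w" if "w \<in> W - {h g}" for w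
    using arb_in_arc[OF assms(1), of w] that by auto
  ultimately show ?thesis using head arb_head[OF assms(1)] unfolding arb_def by auto
qed

lemma arb_no_in_arc: "arb (W - {w}) S \<Longrightarrow> a \<in> S \<Longrightarrow> h a \<noteq> w"
  using arb_head by fastforce

lemma arb_exchange_root:
  assumes "arb W S" "k \<in> S" "h k = h g" "t g \<notin> W"
  shows "arb W (insert g (S - {k}))"
  by (rule arb_insert_root) (use arb_remove[OF assms(1,2)] arb_head[OF assms(1,2)] assms in auto)

lemma arc_flip_exchange: "k \<in> S \<Longrightarrow> g \<notin> S \<Longrightarrow> arc_flip S (insert g (S - {k}))"
  unfolding arc_flip_def by (rule exI[of _ k], rule exI[of _ g]) auto

lemma semicomplete_remove_vertex: "semicomplete W E \<Longrightarrow> semicomplete (W - X) E"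
  unfolding semicomplete_def by auto

section \<open>Deletion and contraction of a root arc\<close>

lemma semicomplete_remove_root_arc:
  assumes "semicomplete W E" "t g \<notin> W"
  shows "semicomplete W (E - {g})"
proof -
  have "\<exists>a\<in>E - {g}. t a = x \<and> h a = y \<or> t a = y \<and> h a = x" if xy: "x \<in> W" "y \<in> W" "x \<noteq> y" for x y
  proof -
    obtain a where "a \<in> E" "t a = x \<and> h a = y \<or> t a = y \<and> h a = x"
      using assms(1) xy unfolding semicomplete_def by blast
    moreover have "a \<noteq> g" using calculation assms(2) xy by auto
    ultimately show ?thesis by auto
  qed
  then show ?thesis using assms(1) unfolding semicomplete_def by simp
qed

text \<open>The recursion behind the induction: an arborescence either survives the deletion of
  \<open>g\<close> or comes from the contraction of \<open>g\<close>.\<close>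

lemma arbs_split:
  assumes "root_arc W E g"
  shows "arbs W E = arbs W (E - {g}) \<union> insert g ` arbs (W - {h g}) E"
    and "arbs W (E - {g}) \<inter> insert g ` arbs (W - {h g}) E = {}"
    and "S \<in> arbs (W - {h g}) E \<Longrightarrow> g \<notin> S"
proof -
  have g: "g \<in> E" "h g \<in> W" "t g \<notin> W" using assms by (auto simp: root_arc_def)
  show "arbs W E = arbs W (E - {g}) \<union> insert g ` arbs (W - {h g}) E"
  proof (intro equalityI subsetI)
    fix S assume S: "S \<in> arbs W E"
    show "S \<in> arbs W (E - {g}) \<union> insert g ` arbs (W - {h g}) E"
    proof (cases "g \<in> S")
      case True
      then have "S - {g} \<in> arbs (W - {h g}) E" "S = insert g (S - {g})"
        using S arb_remove[of W S g] by (auto simp: arbs_def)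
      then show ?thesis by blast
    next
      case False
      then show ?thesis using S by (auto simp: arbs_def)
    qed
  next
    fix S assume "S \<in> arbs W (E - {g}) \<union> insert g ` arbs (W - {h g}) E"
    then show "S \<in> arbs W E" using g arb_insert_root[of W g] by (auto simp: arbs_def)
  qed
  show "arbs W (E - {g}) \<inter> insert g ` arbs (W - {h g}) E = {}" by (auto simp: arbs_def)
  show "g \<notin> S" if "S \<in> arbs (W - {h g}) E" using that arb_no_in_arc by (auto simp: arbs_def)
qed

text \<open>Crossing to the contraction side is always possible, since a root arc can replace
  whatever arc enters its head. The price is that the second path must start at a prescribed
  place.\<close>

lemma delete_then_contract:
  assumes g: "root_arc W E g"
    and xs: "flip_path (arbs W (E - {g})) xs" and k: "k \<in> last xs" "h k = h g"
    and ys: "flip_path (arbs (W - {h g}) E) ys" "hd ys = last xs - {k}"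
  shows "flip_path (arbs W E) (xs @ map (insert g) ys)" "hd (xs @ map (insert g) ys) = hd xs"
    "last (xs @ map (insert g) ys) = insert g (last ys)"
proof -
  have m: "flip_path (insert g ` arbs (W - {h g}) E) (map (insert g) ys)"
    "hd (map (insert g) ys) = insert g (hd ys)" "last (map (insert g) ys) = insert g (last ys)"
    by (rule flip_path_map_insert[OF ys(1)], erule arbs_split(3)[OF g])+
  have "g \<notin> last xs" using flip_path_last[OF xs] by (auto simp: arbs_def)
  then have "arc_flip (last xs) (hd (map (insert g) ys))"
    unfolding m ys(2) using k by (intro arc_flip_exchange) auto
  note a = flip_path_append[OF xs m(1) arbs_split(2)[OF g] this]
  show "flip_path (arbs W E) (xs @ map (insert g) ys)" using a arbs_split(1)[OF g] by simp
  show "hd (xs @ map (insert g) ys) = hd xs" by (rule a)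
  show "last (xs @ map (insert g) ys) = insert g (last ys)" unfolding a m ..
qed

text \<open>This crossing gives up \<open>g\<close> for another arc \<open>k\<close> with the same
  head. That the result is an arborescence is not automatic; each caller has to arrange the end of
  \<open>ys\<close> accordingly.\<close>

lemma contract_then_delete:
  assumes g: "root_arc W E g"
    and ys: "flip_path (arbs (W - {h g}) E) ys"
    and xs: "flip_path (arbs W (E - {g})) xs" "hd xs = insert k (last ys)" and k: "h k = h g"
  shows "flip_path (arbs W E) (map (insert g) ys @ xs)" "hd (map (insert g) ys @ xs) = insert g (hd ys)"
    "last (map (insert g) ys @ xs) = last xs"
proof -
  have m: "flip_path (insert g ` arbs (W - {h g}) E) (map (insert g) ys)"
    "hd (map (insert g) ys) = insert g (hd ys)" "last (map (insert g) ys) = insert g (last ys)"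
    by (rule flip_path_map_insert[OF ys(1)], erule arbs_split(3)[OF g])+
  have "last ys \<in> arbs (W - {h g}) E" by (rule flip_path_last[OF ys])
  then have "g \<notin> last ys" "k \<notin> last ys" using k arb_no_in_arc by (auto simp: arbs_def)
  moreover have "g \<notin> hd xs" using flip_path_hd[OF xs(1)] by (auto simp: arbs_def)
  ultimately have "arc_flip (last (map (insert g) ys)) (hd xs)"
    unfolding m xs(2) by (intro arc_flip_insert) auto
  moreover have "insert g ` arbs (W - {h g}) E \<inter> arbs W (E - {g}) = {}" using arbs_split(2)[OF g] by auto
  ultimately have a: "flip_path (insert g ` arbs (W - {h g}) E \<union> arbs W (E - {g})) (map (insert g) ys @ xs)"
    "hd (map (insert g) ys @ xs) = hd (map (insert g) ys)" "last (map (insert g) ys @ xs) = last xs"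
    using flip_path_append[OF m(1) xs(1)] by auto
  show "flip_path (arbs W E) (map (insert g) ys @ xs)"
    using a(1) arbs_split(1)[OF g] by (simp add: Un_commute)
  show "hd (map (insert g) ys @ xs) = insert g (hd ys)" unfolding a m ..
  show "last (map (insert g) ys @ xs) = last xs" by (rule a)
qed

lemma contract_forced:
  assumes g: "root_arc W E g" and "arbs W (E - {g}) = {}"
    and ys: "flip_path (arbs (W - {h g}) E) ys"
  shows "flip_path (arbs W E) (map (insert g) ys)" "hd (map (insert g) ys) = insert g (hd ys)"
    "last (map (insert g) ys) = insert g (last ys)"
proof -
  have m: "flip_path (insert g ` arbs (W - {h g}) E) (map (insert g) ys)"
    "hd (map (insert g) ys) = insert g (hd ys)" "last (map (insert g) ys) = insert g (last ys)"
    by (rule flip_path_map_insert[OF ys(1)], erule arbs_split(3)[OF g])+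
  then show "flip_path (arbs W E) (map (insert g) ys)" "hd (map (insert g) ys) = insert g (hd ys)"
    "last (map (insert g) ys) = insert g (last ys)"
    using arbs_split(1)[OF g] assms(2) by simp_all
qed

text \<open>Forgetting the arc entering \<open>v\<close> groups the arborescences into fibers over
  the forests on \<open>W - {v}\<close>, and \<open>T\<close> lies in one of them. The two
  alternatives in the last assumption become those of \<open>sweep\<close>.\<close>

lemma sweep_arbs:
  assumes fin: "finite E" and Fs: "flip_path (arbs (W - {v}) E) Fs"
    and T: "T \<in> arbs W E"
    and e: "root_arc W E e" "root_arc W E e'" "h e = v" "h e' = v" "e \<noteq> e'"
    and alt: "(\<exists>f. root_arc W E f \<and> h f = v \<and> f \<noteq> e \<and> f \<noteq> e') \<or> (\<forall>f. root_arc W E f \<longrightarrow> h f = v)"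
  shows "\<exists>xs. flip_path (arbs W E) xs \<and> hd xs = T \<and> last xs \<in> {insert e (last Fs), insert e' (last Fs)}"
proof -
  define D where "D F = {d \<in> E. h d = v \<and> arb W (insert d F)}" for F
  define V where "V = {d \<in> E. h d = v}"
  define C where "C = {d. root_arc W E d \<and> h d = v}"
  have v: "v \<in> W" using e by (auto simp: root_arc_def)
  have base: "F \<subseteq> E" "arb (W - {v}) F" if "F \<in> set Fs" for F
    using that Fs by (auto simp: flip_path_def arbs_def)
  have CD: "C \<subseteq> D F" if "F \<in> set Fs" for F
    using base[OF that] arb_insert_root[of W _ F] by (auto simp: C_def D_def root_arc_def)
  have "fibered V D C Fs"
    unfolding fibered_def
  proof (intro conjI ballI)
    show "distinct Fs" "successively arc_flip Fs" using Fs by (auto simp: flip_path_def)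
    fix F assume F: "F \<in> set Fs"
    show "F \<inter> V = {}" using arb_no_in_arc[OF base(2)[OF F]] by (auto simp: V_def)
    show "finite (D F)" using fin by (simp add: D_def)
    show "C \<subseteq> D F" by (rule CD[OF F])
    show "D F \<subseteq> V" by (auto simp: D_def V_def)
  qed
  moreover obtain a where a: "a \<in> T" "h a = v" using arb_in_arc[of W T v] T v by (auto simp: arbs_def)
  then have "T - {a} \<in> arbs (W - {v}) E" "insert a (T - {a}) = T"
    using T arb_remove[of W T a] by (auto simp: arbs_def)
  then have F: "T - {a} \<in> set Fs" "insert a (T - {a}) = T" "a \<in> D (T - {a})"
    using Fs T a by (auto simp: flip_path_def D_def arbs_def)
  moreover have "e \<in> C" "e' \<in> C" using e by (auto simp: C_def)
  moreover have "(\<exists>f\<in>C. f \<noteq> e \<and> f \<noteq> e') \<or> (\<forall>F\<in>set Fs. D F = C)"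
  proof (cases "\<exists>f. root_arc W E f \<and> h f = v \<and> f \<noteq> e \<and> f \<noteq> e'")
    case True
    then show ?thesis by (auto simp: C_def)
  next
    case False
    then have only: "h f = v" if "root_arc W E f" for f using alt that by blast
    have "D F \<subseteq> C" if "F \<in> set Fs" for F
    proof
      fix d assume d: "d \<in> D F"
      then have "arb W (insert d F)" "insert d F \<subseteq> E" using base[OF that] by (auto simp: D_def)
      \<comment> \<open>Some arc leaves the root. All root arcs end in \<open>v\<close>, and
        \<open>F\<close> has no arc into \<open>v\<close>, so this arc is \<open>d\<close>.\<close>
      then obtain b where b: "b \<in> insert d F" "h b \<in> W" "t b \<notin> W" "b \<in> E"
        using arb_entering[of W "insert d F" W] v by blast
      then have "h b = v" using only by (auto simp: root_arc_def)
      then have "b = d" using b(1) arb_no_in_arc[OF base(2)[OF that]] by auto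
      then show "d \<in> C" using b d by (auto simp: C_def D_def root_arc_def)
    qed
    then show ?thesis using CD by blast
  qed
  ultimately have "\<exists>xs. flip_path (fiber_union D Fs) xs \<and> hd xs = insert a (T - {a}) \<and>
      last xs \<in> {insert e (last Fs), insert e' (last Fs)}"
    using e(5) by (intro sweep[of V D C]) auto
  moreover have "fiber_union D Fs = arbs W E"
  proof (intro equalityI subsetI)
    fix S assume "S \<in> fiber_union D Fs"
    then show "S \<in> arbs W E" using base by (auto simp: fiber_union_def fiber_def D_def arbs_def)
  next
    fix S assume S: "S \<in> arbs W E"
    then obtain b where b: "b \<in> S" "h b = v" using arb_in_arc[of W S v] v by (auto simp: arbs_def)
    then have "S - {b} \<in> arbs (W - {v}) E" "insert b (S - {b}) = S"
      using S arb_remove[of W S b] by (auto simp: arbs_def)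
    then have "S - {b} \<in> set Fs" "b \<in> D (S - {b})" "S = insert b (S - {b})"
      using Fs S b by (auto simp: flip_path_def D_def arbs_def)
    then show "S \<in> fiber_union D Fs" unfolding fiber_union_def fiber_def by blast
  qed
  ultimately show ?thesis using F(2) by simp
qed

section \<open>The two statements of the induction\<close>

definition double_root :: "'a set \<Rightarrow> 'b set \<Rightarrow> 'b \<Rightarrow> 'b \<Rightarrow> bool" where
  "double_root W E e e' \<longleftrightarrow> root_arc W E e \<and> root_arc W E e' \<and> e \<noteq> e' \<and> h e = h e'"

definition rich_traceable :: "'a set \<Rightarrow> 'b set \<Rightarrow> bool" where
  "rich_traceable W E \<longleftrightarrow> (\<forall>e e' T. double_root W E e e' \<longrightarrow> T \<in> arbs W E \<longrightarrow>
     (\<exists>xs. flip_path (arbs W E) xs \<and> hd xs = T \<and> (e \<in> last xs \<or> e' \<in> last xs)))"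

text \<open>
  Every root arc can be prescribed at one end of a Hamiltonian path. With a \<open>g\<close> that
  is not a root arc, this is mere traceability.
\<close>

definition traceable :: "'a set \<Rightarrow> 'b set \<Rightarrow> bool" where
  "traceable W E \<longleftrightarrow> (\<forall>g. arbs W E \<noteq> {} \<longrightarrow>
     (\<exists>xs. flip_path (arbs W E) xs \<and> (root_arc W E g \<longrightarrow> g \<in> hd xs)))"

lemma root_arc_delete: "root_arc W E a \<Longrightarrow> a \<noteq> g \<Longrightarrow> root_arc W (E - {g}) a"
  and root_arc_contract: "root_arc W E a \<Longrightarrow> h a \<noteq> w \<Longrightarrow> root_arc (W - {w}) E a"
  by (auto simp: root_arc_def)

lemma double_root_delete: "double_root W E e e' \<Longrightarrow> h g \<noteq> h e \<Longrightarrow> double_root W (E - {g}) e e'"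
  and double_root_contract: "double_root W E e e' \<Longrightarrow> w \<noteq> h e \<Longrightarrow> double_root (W - {w}) E e e'"
  by (auto simp: double_root_def root_arc_def)

lemma rich_traceableD:
  assumes "rich_traceable W E" "double_root W E e e'" "T \<in> arbs W E"
  obtains xs where "flip_path (arbs W E) xs" "hd xs = T" "e \<in> last xs \<or> e' \<in> last xs"
  using assms unfolding rich_traceable_def by blast

lemma arbs_remove: "T \<in> arbs W E \<Longrightarrow> a \<in> T \<Longrightarrow> T - {a} \<in> arbs (W - {h a}) E"
  using arb_remove by (auto simp: arbs_def)

text \<open>The start lies on the deletion side. That path may end anywhere, because the crossing to
  the contraction side is always possible and the path there can start anywhere.\<close>

lemma rich_traceable_absent:
  assumes g: "root_arc W E g" "h g \<noteq> h e" "g \<notin> T"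
    and e: "double_root W E e e'" and T: "T \<in> arbs W E"
    and IH: "rich_traceable W (E - {g})" "rich_traceable (W - {h g}) E"
  shows "\<exists>xs. flip_path (arbs W E) xs \<and> hd xs = T \<and> (e \<in> last xs \<or> e' \<in> last xs)"
proof -
  have e1: "double_root W (E - {g}) e e'" "double_root (W - {h g}) E e e'"
    by (rule double_root_delete[OF e g(2)], rule double_root_contract[OF e g(2)])
  have "T \<in> arbs W (E - {g})" using T g(3) by (auto simp: arbs_def)
  then obtain xs where xs: "flip_path (arbs W (E - {g})) xs" "hd xs = T"
    using rich_traceableD[OF IH(1) e1(1)] by metis
  from flip_path_last[OF xs(1)] have S: "last xs \<in> arbs W E" by (auto simp: arbs_def)
  moreover have "h g \<in> W" using g(1) by (simp add: root_arc_def)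
  ultimately obtain k where k: "k \<in> last xs" "h k = h g"
    using arb_in_arc[of W "last xs" "h g"] by (auto simp: arbs_def)
  have "last xs - {k} \<in> arbs (W - {h g}) E" using arbs_remove[OF S k(1)] k(2) by simp
  then obtain ys where ys: "flip_path (arbs (W - {h g}) E) ys" "hd ys = last xs - {k}"
    "e \<in> last ys \<or> e' \<in> last ys"
    using rich_traceableD[OF IH(2) e1(2)] by metis
  from delete_then_contract[OF g(1) xs(1) k ys(1,2)] show ?thesis using xs(2) ys(3) by (metis insertCI)
qed

text \<open>The start lies on the contraction side. The path there ends with a root arc to
  \<open>h e\<close>, so \<open>k\<close>, which leads from \<open>h e\<close> to
  \<open>h g\<close>, can replace \<open>g\<close>. This is the purpose of the condition on the end
  of the path.\<close>

lemma rich_traceable_out_arc: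
  assumes g: "root_arc W E g" "h g \<noteq> h e" "g \<in> T"
    and e: "double_root W E e e'" and T: "T \<in> arbs W E"
    and k: "k \<in> E" "t k = h e" "h k = h g"
    and IH: "rich_traceable W (E - {g})" "rich_traceable (W - {h g}) E"
  shows "\<exists>xs. flip_path (arbs W E) xs \<and> hd xs = T \<and> (e \<in> last xs \<or> e' \<in> last xs)"
proof -
  have e1: "double_root W (E - {g}) e e'" "double_root (W - {h g}) E e e'"
    by (rule double_root_delete[OF e g(2)], rule double_root_contract[OF e g(2)])
  obtain ys where ys: "flip_path (arbs (W - {h g}) E) ys" "hd ys = T - {g}" "e \<in> last ys \<or> e' \<in> last ys"
    using rich_traceableD[OF IH(2) e1(2) arbs_remove[OF T g(3)]] by metis
  then obtain c where c: "c \<in> last ys" "c = e \<or> c = e'" by auto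
  then have c1: "h c = t k" "t c \<notin> W" using e k(2) by (auto simp: double_root_def root_arc_def)
  have S: "arb (W - {h k}) (last ys)" "last ys \<subseteq> E" using flip_path_last[OF ys(1)] k(3) by (auto simp: arbs_def)
  have "g \<notin> last ys" by (rule arbs_split(3)[OF g(1) flip_path_last[OF ys(1)]])
  moreover have "k \<noteq> g" using g(1) e k(2) by (auto simp: root_arc_def double_root_def)
  moreover have "arb W (insert k (last ys))"
    by (rule arb_insert_arc[OF S(1) _ _ c(1) c1]) (use g k in \<open>auto simp: root_arc_def\<close>)
  ultimately have "insert k (last ys) \<in> arbs W (E - {g})" using S k(1) by (auto simp: arbs_def)
  then obtain xs where xs: "flip_path (arbs W (E - {g})) xs" "hd xs = insert k (last ys)"
    "e \<in> last xs \<or> e' \<in> last xs"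
    using rich_traceableD[OF IH(1) e1(1)] by metis
  have "insert g (hd ys) = T" using ys(2) g(3) by auto
  with contract_then_delete[OF g(1) ys(1) xs(1,2) k(3)] xs(3) show ?thesis by metis
qed

text \<open>
  The path found here ends in a forest to which an arc entering \<open>w\<close> can be added. If
  \<open>b\<close> is a root arc whose head \<open>u\<close> has an arc to \<open>w\<close>, then it
  suffices that the path ends with \<open>b\<close>; otherwise \<open>w\<close>, which belongs to the
  root here, has an arc to \<open>u\<close> parallel to \<open>b\<close>, and the end can be chosen
  freely.
\<close>

lemma base_path:
  assumes sc: "semicomplete W E"
    and S: "S \<in> arbs W E'" "E' \<subseteq> E" "v \<in> W" "w \<in> W" "v \<noteq> w"
    and in_w: "\<And>a. a \<in> E' \<Longrightarrow> h a = w \<Longrightarrow> t a \<in> W - {v}"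
    and E': "\<And>a. a \<in> E \<Longrightarrow> t a \<in> W \<Longrightarrow> a \<in> E'"
    and IH: "rich_traceable (W - {w} - {v}) E" "traceable (W - {w} - {v}) E"
  shows "\<exists>Fs k. flip_path (arbs (W - {w} - {v}) E) Fs \<and> k \<in> E' \<and> h k = w \<and> arb (W - {v}) (insert k (last Fs))"
proof -
  have L: "W - {v} - {w} = W - {w} - {v}" by auto
  have aS: "arb W S" "S \<subseteq> E'" using S(1) by (auto simp: arbs_def)
  obtain a where a: "a \<in> S" "h a = v" using arb_in_arc[OF aS(1) S(3)] by blast
  define S1 where "S1 = S - {a}"
  have S1: "arb (W - {v}) S1" "S1 \<subseteq> E'" using arb_remove[OF aS(1) a(1)] a aS by (auto simp: S1_def)
  have "W - {v} \<noteq> {}" using S by auto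
  then obtain b where b: "b \<in> S1" "h b \<in> W - {v}" "t b \<notin> W - {v}"
    using arb_entering[OF S1(1) order_refl] by blast
  \<comment> \<open>All arcs of \<open>E'\<close> into \<open>w\<close> start in
    \<open>W - {v}\<close>, but \<open>b\<close> does not.\<close>
  have bw: "h b \<noteq> w" using in_w b S1 by blast
  have rb: "root_arc (W - {w} - {v}) E b" using b bw S1 S(2) by (auto simp: root_arc_def)
  obtain k where k: "k \<in> S1" "h k = w" using arb_in_arc[OF S1(1), of w] S by blast
  have F: "S1 - {k} \<in> arbs (W - {w} - {v}) E"
    using arb_remove[OF S1(1) k(1)] k(2) S1 S(2) by (auto simp: L arbs_def)
  obtain m where m: "m \<in> E" "t m = h b \<and> h m = w \<or> t m = w \<and> h m = h b"
    using sc b bw S(4) unfolding semicomplete_def by blast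
  show ?thesis
  proof (cases "t m = h b \<and> h m = w")
    case True
    obtain xs where xs: "flip_path (arbs (W - {w} - {v}) E) xs" "b \<in> hd xs"
      using IH(2) F rb unfolding traceable_def by blast
    have "hd xs \<in> arbs (W - {w} - {v}) E" by (rule flip_path_hd[OF xs(1)])
    then have "arb (W - {v} - {h m}) (hd xs)" using True by (auto simp: L arbs_def)
    then have "arb (W - {v}) (insert m (hd xs))"
      by (rule arb_insert_arc) (use True xs b bw S in auto)
    moreover have "m \<in> E'" using E' m True b by auto
    ultimately show ?thesis using flip_path_rev[OF xs(1)] True by metis
  next
    case False
    then have m2: "t m = w" "h m = h b" using m by auto
    have "double_root (W - {w} - {v}) E b m"
      using rb m(1) m2 b S by (auto simp: double_root_def root_arc_def)
    then obtain xs where xs: "flip_path (arbs (W - {w} - {v}) E) xs" "hd xs = S1 - {k}"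
      using rich_traceableD[OF IH(1) _ F] by metis
    \<comment> \<open>The path was started at \<open>S1 - {k}\<close>, so its reversal ends there,
      and adding \<open>k\<close> restores \<open>S1\<close>.\<close>
    have "arb (W - {v}) (insert k (last (rev xs)))" unfolding flip_path_rev(3)[OF xs(1)] xs(2)
      using S1(1) k by (simp add: insert_absorb)
    then show ?thesis using flip_path_rev(1)[OF xs(1)] k S1 by (metis subsetD)
  qed
qed

text \<open>Contracting \<open>g\<close> makes \<open>f\<close> a third root arc to
  \<open>h e\<close>, so \<open>sweep_arbs\<close> lifts any path of forests. The forests come from
  \<open>base_path\<close>, so that at the end an arc \<open>k\<close> can replace
  \<open>g\<close>.\<close>

lemma rich_traceable_in_arc:
  assumes sc: "semicomplete W E"
    and g: "root_arc W E g" "h g \<noteq> h e" "g \<in> T"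
    and e: "double_root W E e e'" and T: "T \<in> arbs W E"
    and f: "f \<in> E" "t f = h g" "h f = h e"
    and no_out: "\<And>k. k \<in> E \<Longrightarrow> t k = h e \<Longrightarrow> h k \<noteq> h g"
    and in_T: "\<And>a. root_arc W E a \<Longrightarrow> h a \<noteq> h e \<Longrightarrow> a \<in> T"
    and IH: "rich_traceable W (E - {g})" "rich_traceable (W - {h g}) E"
      "rich_traceable (W - {h g} - {h e}) E" "traceable (W - {h g} - {h e}) E"
  shows "\<exists>xs. flip_path (arbs W E) xs \<and> hd xs = T \<and> (e \<in> last xs \<or> e' \<in> last xs)"
proof -
  have e1: "double_root W (E - {g}) e e'" "double_root (W - {h g}) E e e'"
    by (rule double_root_delete[OF e g(2)], rule double_root_contract[OF e g(2)])
  have Tg: "T - {g} \<in> arbs (W - {h g}) E" "insert g (T - {g}) = T"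
    using arbs_remove[OF T g(3)] g(3) by auto
  have W: "h g \<in> W" "h e \<in> W" "t g \<notin> W" "t e \<notin> W" "t e' \<notin> W" "h e' = h e" "e \<in> E" "e' \<in> E"
    using g e by (auto simp: root_arc_def double_root_def)
  show ?thesis
  proof (cases "arbs W (E - {g}) = {}")
    case True
    obtain ys where ys: "flip_path (arbs (W - {h g}) E) ys" "hd ys = T - {g}" "e \<in> last ys \<or> e' \<in> last ys"
      using rich_traceableD[OF IH(2) e1(2) Tg(1)] by metis
    from contract_forced[OF g(1) True ys(1)] ys Tg(2) show ?thesis by (metis insertCI)
  next
    case False
    then obtain S where S: "S \<in> arbs W (E - {g})" by auto
    \<comment> \<open>Another root arc to \<open>h g\<close> would belong to \<open>T\<close> by
      \<open>in_T\<close>, giving two arcs of \<open>T\<close> with the same head; arcs from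
      \<open>h e\<close> are excluded by \<open>no_out\<close>.\<close>
    have "t a \<in> W - {h e}" if "a \<in> E - {g}" "h a = h g" for a
    proof -
      have "t a \<in> W"
      proof (rule ccontr)
        assume "t a \<notin> W"
        then have "a \<in> T" using that W g by (intro in_T) (auto simp: root_arc_def)
        then show False using arb_unique[of W T a g] T g(3) that by (auto simp: arbs_def)
      qed
      then show ?thesis using no_out that by auto
    qed
    moreover have "a \<in> E - {g}" if "a \<in> E" "t a \<in> W" for a using that W by auto
    ultimately obtain Fs k where Fs: "flip_path (arbs (W - {h g} - {h e}) E) Fs"
      and k: "k \<in> E - {g}" "h k = h g" "arb (W - {h e}) (insert k (last Fs))"
      using base_path[OF sc S _ W(2,1) g(2)[symmetric] _ _ IH(3,4)] by blast
    have r: "root_arc (W - {h g}) E e" "root_arc (W - {h g}) E e'" "e \<noteq> e'"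
      using e1(2) by (auto simp: double_root_def)
    have "root_arc (W - {h g}) E f \<and> h f = h e \<and> f \<noteq> e \<and> f \<noteq> e'"
      using f W g(2) by (auto simp: root_arc_def)
    then obtain ys where ys: "flip_path (arbs (W - {h g}) E) ys" "hd ys = T - {g}"
      "last ys \<in> {insert e (last Fs), insert e' (last Fs)}"
      using sweep_arbs[OF _ Fs Tg(1) r(1,2) refl W(6) r(3)] sc unfolding semicomplete_def by blast
    then obtain c where c: "last ys = insert c (last Fs)" "c = e \<or> c = e'" by auto
    \<comment> \<open>The forest with \<open>k\<close> lives on \<open>W - {h e}\<close>, so the
      root arc \<open>c\<close> to \<open>h e\<close> completes it.\<close>
    have "arb (W - {h c}) (insert k (last Fs))" using k(3) c(2) W(6) by auto
    then have "arb W (insert c (insert k (last Fs)))"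
      by (rule arb_insert_root) (use c(2) W in auto)
    then have "arb W (insert k (last ys))" unfolding c(1) by (simp add: insert_commute)
    moreover have "g \<notin> last ys" by (rule arbs_split(3)[OF g(1) flip_path_last[OF ys(1)]])
    moreover have "last ys \<subseteq> E" using flip_path_last[OF ys(1)] by (auto simp: arbs_def)
    ultimately have "insert k (last ys) \<in> arbs W (E - {g})" using k(1) by (auto simp: arbs_def)
    then obtain xs where xs: "flip_path (arbs W (E - {g})) xs" "hd xs = insert k (last ys)"
      "e \<in> last xs \<or> e' \<in> last xs"
      using rich_traceableD[OF IH(1) e1(1)] by metis
    from contract_then_delete[OF g(1) ys(1) xs(1,2) k(2)] xs(3) ys(2) Tg(2) show ?thesis by metis
  qed
qed

text \<open>The root arcs with heads other than \<open>h e\<close> decide the case. If there are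
  none, \<open>sweep_arbs\<close> applies. If one is missing from \<open>T\<close>, then
  \<open>T\<close> is on its deletion side. Otherwise \<open>T\<close> contains them all, and the
  direction of a clique arc between \<open>h g\<close> and \<open>h e\<close> matters.\<close>

lemma rich_traceable_step:
  assumes sc: "semicomplete W E"
    and IH: "\<And>W' E'. semicomplete W' E' \<Longrightarrow> card W' + card E' < card W + card E \<Longrightarrow>
      rich_traceable W' E' \<and> traceable W' E'"
  shows "rich_traceable W E"
  unfolding rich_traceable_def
proof (intro allI impI)
  fix e e' T
  assume e: "double_root W E e e'" and T: "T \<in> arbs W E"
  have fin: "finite W" "finite E" using sc by (auto simp: semicomplete_def)
  have v: "h e \<in> W" "h e' = h e" "root_arc W E e" "root_arc W E e'" "e \<noteq> e'"
    using e by (auto simp: double_root_def root_arc_def)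
  have contract: "card (W - {w}) < card W" "card (W - {w} - X) < card W" if "w \<in> W" for w X
  proof -
    show 1: "card (W - {w}) < card W" using fin(1) that by (rule card_Diff1_less)
    show "card (W - {w} - X) < card W"
      using 1 card_mono[of "W - {w}" "W - {w} - X"] fin(1) by auto
  qed
  have con: "rich_traceable (W - {w}) E" "traceable (W - {w}) E"
    "rich_traceable (W - {w} - X) E" "traceable (W - {w} - X) E" if "w \<in> W" for w X
    using IH[OF semicomplete_remove_vertex[OF sc], of "{w}"]
      IH[OF semicomplete_remove_vertex[OF semicomplete_remove_vertex[OF sc]], of "{w}" X]
      contract[OF that] by auto
  have del: "rich_traceable W (E - {g})" if "root_arc W E g" for g
    using IH[OF semicomplete_remove_root_arc[OF sc, of g]] that card_Diff1_less[OF fin(2), of g]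
    by (auto simp: root_arc_def)
  show "\<exists>xs. flip_path (arbs W E) xs \<and> hd xs = T \<and> (e \<in> last xs \<or> e' \<in> last xs)"
  proof (cases "\<forall>a. root_arc W E a \<longrightarrow> h a = h e")
    case True
    obtain a where a: "a \<in> T" "h a = h e" using arb_in_arc[of W T "h e"] T v(1) by (auto simp: arbs_def)
    then have "T - {a} \<in> arbs (W - {h e}) E" using arbs_remove[OF T a(1)] by simp
    then obtain Fs where "flip_path (arbs (W - {h e}) E) Fs" using con(2)[OF v(1)] unfolding traceable_def by blast
    from sweep_arbs[OF fin(2) this T v(3,4) refl v(2,5)] True show ?thesis by blast
  next
    case False
    then obtain g where g: "root_arc W E g" "h g \<noteq> h e" by auto
    have w: "h g \<in> W" using g by (simp add: root_arc_def)
    show ?thesis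
    proof (cases "\<exists>a. root_arc W E a \<and> h a \<noteq> h e \<and> a \<notin> T")
      case True
      then obtain a where a: "root_arc W E a" "h a \<noteq> h e" "a \<notin> T" by auto
      then have "h a \<in> W" by (simp add: root_arc_def)
      from rich_traceable_absent[OF a e T del[OF a(1)] con(1)[OF this]] show ?thesis .
    next
      case False
      then have in_T: "a \<in> T" if "root_arc W E a" "h a \<noteq> h e" for a using that by auto
      show ?thesis
      proof (cases "\<exists>k\<in>E. t k = h e \<and> h k = h g")
        case True
        then obtain k where "k \<in> E" "t k = h e" "h k = h g" by auto
        from rich_traceable_out_arc[OF g in_T[OF g] e T this del[OF g(1)] con(1)[OF w]] show ?thesis .
      next
        case False
        then obtain f where f: "f \<in> E" "t f = h g" "h f = h e"
          using sc w v(1) g(2) unfolding semicomplete_def by metis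
        show ?thesis
          by (rule rich_traceable_in_arc[OF sc g in_T[OF g] e T f _ in_T del[OF g(1)] con(1,3,4)[OF w]])
            (use False in auto)
      qed
    qed
  qed
qed

section \<open>Traceability with one prescribed root arc\<close>

lemma traceable_forced:
  assumes e: "root_arc W E e" "arbs W (E - {e}) = {}" "arbs W E \<noteq> {}"
    and simple: "\<And>a b. root_arc W E a \<Longrightarrow> root_arc W E b \<Longrightarrow> h a = h b \<Longrightarrow> a = b"
    and IH: "traceable (W - {h e}) E"
  shows "\<exists>xs. flip_path (arbs W E) xs \<and> (root_arc W E g \<longrightarrow> g \<in> hd xs)"
proof -
  have "arbs (W - {h e}) E \<noteq> {}" using arbs_split(1)[OF e(1)] e by auto
  then obtain xs where xs: "flip_path (arbs (W - {h e}) E) xs" "root_arc (W - {h e}) E g \<longrightarrow> g \<in> hd xs"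
    using IH unfolding traceable_def by blast
  \<comment> \<open>Without parallel root arcs, any other \<open>g\<close> has a different head and
    survives the contraction of \<open>e\<close> as a root arc.\<close>
  have "g = e \<or> root_arc (W - {h e}) E g" if "root_arc W E g"
    using simple[OF that e(1)] root_arc_contract[OF that] by blast
  with contract_forced[OF e(1,2) xs(1)] xs(2) show ?thesis by (metis insert_iff)
qed

lemma traceable_step:
  assumes sc: "semicomplete W E" and rich: "rich_traceable W E"
    and IH: "\<And>W' E'. semicomplete W' E' \<Longrightarrow> card W' + card E' < card W + card E \<Longrightarrow>
      rich_traceable W' E' \<and> traceable W' E'"
  shows "traceable W E"
  unfolding traceable_def
proof (intro allI impI)
  fix g
  assume ne: "arbs W E \<noteq> {}"
  then obtain S where S: "S \<in> arbs W E" by auto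
  have fin: "finite W" "finite E" using sc by (auto simp: semicomplete_def)
  show "\<exists>xs. flip_path (arbs W E) xs \<and> (root_arc W E g \<longrightarrow> g \<in> hd xs)"
  proof (cases "W = {}")
    case True
    then have "arbs W E = {{}}" "\<not> root_arc W E g" by (auto simp: arbs_def arb_empty root_arc_def)
    then show ?thesis using flip_path_singleton by metis
  next
    case W: False
    show ?thesis
    proof (cases "\<exists>e e'. double_root W E e e'")
      case True
      then obtain e e' where e: "double_root W E e e'" by auto
      \<comment> \<open>If \<open>g\<close> is a root arc, it is exchanged into \<open>S\<close> to
        obtain the start.\<close>
      obtain T where T: "T \<in> arbs W E" "root_arc W E g \<longrightarrow> g \<in> T"
      proof (cases "root_arc W E g")
        case True
        obtain k where k: "k \<in> S" "h k = h g" using arb_in_arc[of W S "h g"] S True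
          by (auto simp: arbs_def root_arc_def)
        have "insert g (S - {k}) \<in> arbs W E"
          using arb_exchange_root[of W S k g] S k True by (auto simp: arbs_def root_arc_def)
        then show ?thesis by (intro that) auto
      qed (use S that in auto)
      from rich_traceableD[OF rich e T(1)] T(2) show ?thesis by metis
    next
      case False
      then have simple: "a = b" if "root_arc W E a" "root_arc W E b" "h a = h b" for a b
        using that by (auto simp: double_root_def)
      have con: "rich_traceable (W - {h e}) E" "traceable (W - {h e}) E"
        and del: "traceable W (E - {e})" if "root_arc W E e" for e
        using that IH[OF semicomplete_remove_vertex[OF sc], of "{h e}"] card_Diff1_less[OF fin(1), of "h e"]
          IH[OF semicomplete_remove_root_arc[OF sc, of e]] card_Diff1_less[OF fin(2), of e]
        by (auto simp: root_arc_def)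
      obtain f where f: "root_arc W E f"
        using arb_entering[of W S W] S W by (auto simp: arbs_def root_arc_def)
      show ?thesis
      proof (cases "\<exists>e. root_arc W E e \<and> arbs W (E - {e}) = {}")
        case True
        then obtain e where e: "root_arc W E e" "arbs W (E - {e}) = {}" by auto
        show ?thesis by (rule traceable_forced[OF e ne simple con(2)[OF e(1)]])
      next
        case unforced: False
        then obtain S' where S': "S' \<in> arbs W (E - {f})" using f by auto
        \<comment> \<open>An arborescence avoiding \<open>f\<close> leaves the root along another
          arc.\<close>
        then obtain a where a: "root_arc W E a" "a \<noteq> f"
          using arb_entering[of W S' W] W by (auto simp: arbs_def root_arc_def)
        then have "h a \<noteq> h f" using simple f by blast
        then obtain m where m: "m \<in> E" "t m = h a \<and> h m = h f \<or> t m = h f \<and> h m = h a"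
          using sc a f unfolding semicomplete_def root_arc_def by blast
        \<comment> \<open>The two root arcs are named such that the clique arc \<open>m\<close>
          leads from the head of \<open>e\<close> to that of \<open>e'\<close>.\<close>
        obtain e e' where e: "root_arc W E e" "root_arc W E e'" "e \<noteq> e'" "t m = h e" "h m = h e'"
          using m(2) a f by metis
        have he: "h e \<noteq> h e'" using simple[OF e(1,2)] e(3) by blast
        have "root_arc W (E - {e}) e'" "root_arc W E g \<Longrightarrow> g \<noteq> e \<Longrightarrow> root_arc W (E - {e}) g"
          using e by (auto intro: root_arc_delete)
        moreover have "arbs W (E - {e}) \<noteq> {}" using unforced e(1) by auto
        ultimately obtain xs where xs: "flip_path (arbs W (E - {e})) xs"
          "root_arc W E g \<longrightarrow> g \<noteq> e \<longrightarrow> g \<in> hd xs"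
          using del[OF e(1)] unfolding traceable_def by metis
        have L: "last xs \<in> arbs W E" using flip_path_last[OF xs(1)] by (auto simp: arbs_def)
        then obtain k where k: "k \<in> last xs" "h k = h e"
          using arb_in_arc[of W "last xs" "h e"] e(1) by (auto simp: arbs_def root_arc_def)
        have "last xs - {k} \<in> arbs (W - {h e}) E" using arbs_remove[OF L k(1)] k(2) by simp
        \<comment> \<open>Once \<open>h e\<close> belongs to the root, \<open>m\<close> is a root
          arc parallel to \<open>e'\<close>, so the contraction side can start anywhere.\<close>
        moreover have "double_root (W - {h e}) E e' m"
          using e m(1) he by (auto simp: double_root_def root_arc_def)
        ultimately obtain ys where ys: "flip_path (arbs (W - {h e}) E) ys" "hd ys = last xs - {k}"
          using rich_traceableD[OF con(1)[OF e(1)]] by metis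
        note p = delete_then_contract[OF e(1) xs(1) k ys]
        show ?thesis
        \<comment> \<open>The path runs from arborescences avoiding \<open>e\<close> to those
          containing it. Hence \<open>e\<close> is met at the far end and the path is reversed; any
          other root arc \<open>g\<close> is already at its start.\<close>
        proof (cases "g = e")
          case True
          then show ?thesis using flip_path_rev[OF p(1)] p(3) by (metis insertI1)
        next
          case False
          then show ?thesis using p(1,2) xs(2) by metis
        qed
      qed
    qed
  qed
qed

text \<open>Contraction lowers \<open>card W\<close> and deletion lowers \<open>card E\<close>. For
  given \<open>W\<close> and \<open>E\<close> the rich statement comes first, since the other one
  uses it there.\<close>

theorem semicomplete_traceable:
  assumes "semicomplete W E"
  shows "rich_traceable W E \<and> traceable W E"
  using assms
proof (induction "card W + card E" arbitrary: W E rule: less_induct)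
  case less
  have "rich_traceable W E" by (rule rich_traceable_step[OF less.prems]) (use less.hyps in auto)
  moreover from this have "traceable W E" by (rule traceable_step[OF less.prems]) (use less.hyps in auto)
  ultimately show ?case ..
qed

end

section \<open>The arborescences of a directed multigraph\<close>

lemma bidirect_simps [simp]:
  "verts (bidirect H) = verts H"
  "arcs (bidirect H) = arcs H \<times> UNIV"
  "tail (bidirect H) (e, b) = (if b then tail H e else head H e)"
  "head (bidirect H) (e, b) = (if b then head H e else tail H e)"
  by (auto simp: bidirect_def)

lemma wf_digraph_bidirect: "wf_digraph H \<Longrightarrow> wf_digraph (bidirect H)"
  unfolding wf_digraph_def by auto

context wf_digraph
begin

interpretation B: wf_digraph "bidirect G"
  by (rule wf_digraph_bidirect) unfold_locales

lemma bidirect_ends_in_verts: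
  assumes "B.awalk u p v" "(e, b) \<in> set p"
  shows "tail G e \<in> set (B.awalk_verts u p)" "head G e \<in> set (B.awalk_verts u p)"
  using B.awalk_verts_arc1[OF assms(2), of u] B.awalk_verts_arc2[OF assms] by (auto split: if_splits)

text \<open>If the first arc recurred in either direction, its starting vertex would be visited
  again.\<close>

lemma apath_distinct_fst: "B.apath u p v \<Longrightarrow> distinct (map fst p)"
proof (induction p arbitrary: u)
  case (Cons a p)
  obtain e b where a: "a = (e, b)" by (cases a)
  have p: "B.apath (head (bidirect G) a) p v" "tail (bidirect G) a \<notin> set (B.awalk_verts (head (bidirect G) a) p)"
    using Cons.prems by (auto simp: B.apath_Cons_iff)
  have "B.awalk (head (bidirect G) a) p v" using p(1) by (simp add: B.apath_def)
  from bidirect_ends_in_verts[OF this] have "(e, b') \<notin> set p" for b'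
    using p(2) unfolding a by (auto split: if_splits)
  then show ?case using Cons.IH[OF p(1)] by (auto simp: a)
qed simp

lemma awalk_reverse:
  "B.awalk u p v \<Longrightarrow> B.awalk v (rev (map (\<lambda>(e, b). (e, \<not> b)) p)) u"
proof (induction p arbitrary: u)
  case (Cons a p)
  obtain e b where a: "a = (e, b)" by (cases a)
  have w: "B.awalk (head (bidirect G) a) p v" "e \<in> arcs G" "u = tail (bidirect G) a"
    using Cons.prems by (auto simp: B.awalk_Cons_iff a)
  have "B.awalk (head (bidirect G) a) [(e, \<not> b)] u"
    using w by (auto simp: B.awalk_simps a)
  from B.awalk_appendI[OF Cons.IH[OF w(1)] this] show ?case by (simp add: a)
qed (simp add: B.awalk_Nil_iff)

text \<open>A walk avoiding \<open>e\<close> shortens to a path, which \<open>e\<close> traversed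
  backwards would close to an undirected cycle.\<close>

lemma undirected_tree_bridge:
  assumes "undirected_tree G" "e \<in> arcs G" "B.awalk (tail G e) p (head G e)"
  shows "e \<in> fst ` set p"
proof (rule ccontr)
  assume e: "e \<notin> fst ` set p"
  define q where "q = B.awalk_to_apath p"
  have q: "B.apath (tail G e) q (head G e)" "set q \<subseteq> set p"
    using B.apath_awalk_to_apath[OF assms(3)] B.awalk_to_apath_subset[OF assms(3)] by (auto simp: q_def)
  have aw: "B.awalk (tail G e) q (head G e)" "distinct (B.awalk_verts (tail G e) q)"
    using q(1) by (auto simp: B.apath_def)
  have e1: "B.awalk (head G e) [(e, False)] (tail G e)" using assms(2) by (auto simp: B.awalk_simps)
  have w: "B.awalk (tail G e) (q @ [(e, False)]) (tail G e)" by (rule B.awalk_appendI[OF aw(1) e1])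
  have "B.awalk_verts (tail G e) (q @ [(e, False)]) = B.awalk_verts (tail G e) q @ [tail G e]"
    using B.awalk_verts_append[OF w] by simp
  moreover obtain ws where "B.awalk_verts (tail G e) q = tail G e # ws"
    using B.awhd_of_awalk[OF aw(1)] B.awalk_verts_non_Nil by (metis list.exhaust_sel)
  ultimately have "distinct (tl (B.awalk_verts (tail G e) (q @ [(e, False)])))"
    using aw(2) by auto
  then have "B.cycle (q @ [(e, False)])" unfolding B.cycle_def using w by blast
  moreover have "distinct (map fst (q @ [(e, False)]))" using apath_distinct_fst[OF q(1)] q(2) e by auto
  ultimately have "undirected_cycle G (q @ [(e, False)])" by (simp add: undirected_cycle_def)
  then show False using assms(1) unfolding undirected_tree_def by blast
qed

section \<open>From oriented trees to the cut condition\<close>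

lemma oriented_away_in_path:
  assumes "oriented_away G r" "e \<in> arcs G"
  shows "\<exists>p. B.awalk r p (tail G e) \<and> head G e \<notin> set (B.awalk_verts r p)"
proof -
  obtain p where p: "B.apath r (p @ [(e, True)]) (head G e)" using assms unfolding oriented_away_def by blast
  then have w: "B.awalk r (p @ [(e, True)]) (head G e)" by (simp add: B.apath_def)
  then have "B.awalk r p (tail G e)" by (auto simp: B.awalk_simps)
  moreover have "head G e \<notin> set (B.awalk_verts r p)"
    using p B.awalk_verts_append[OF w] by (auto simp: B.apath_def)
  ultimately show ?thesis by blast
qed

text \<open>Going back from the tail of \<open>e\<close> to \<open>r\<close>, on to the tail of
  \<open>f\<close> and along \<open>f\<close> would join the ends of \<open>e\<close> without using
  \<open>e\<close>.\<close>

lemma arborescence_unique_in_arc: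
  assumes tree: "undirected_tree G" and away: "oriented_away G r"
    and e: "e \<in> arcs G" "f \<in> arcs G" "head G e = head G f"
  shows "e = f"
proof (rule ccontr)
  assume "e \<noteq> f"
  obtain p where p: "B.awalk r p (tail G e)" "head G e \<notin> set (B.awalk_verts r p)"
    using oriented_away_in_path[OF away e(1)] by blast
  obtain q where q: "B.awalk r q (tail G f)" "head G f \<notin> set (B.awalk_verts r q)"
    using oriented_away_in_path[OF away e(2)] by blast
  have ne: "e \<notin> fst ` set p" "e \<notin> fst ` set q"
    using bidirect_ends_in_verts[OF p(1), of e] bidirect_ends_in_verts[OF q(1), of e] p(2) q(2) e(3) by auto
  have f: "B.awalk (tail G f) [(f, True)] (head G e)" using e by (auto simp: B.awalk_simps)
  have "B.awalk (tail G e) (rev (map (\<lambda>(e, b). (e, \<not> b)) p) @ q @ [(f, True)]) (head G e)"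
    by (rule B.awalk_appendI[OF awalk_reverse[OF p(1)] B.awalk_appendI[OF q(1) f]])
  from undirected_tree_bridge[OF tree e(1) this] show False using ne \<open>e \<noteq> f\<close> by (auto simp: image_iff split: prod.splits)
qed

text \<open>If the path used \<open>e\<close> backwards, its initial part would reach the head of
  \<open>e\<close> without \<open>e\<close>. By orientation the tail is reached without
  \<open>e\<close> as well, so \<open>e\<close> would be bypassed.\<close>

lemma arborescence_path_forward:
  assumes tree: "undirected_tree G" and away: "oriented_away G r"
    and p: "B.apath r p v" "(e, b) \<in> set p"
  shows "b"
proof (rule ccontr)
  assume "\<not> b"
  then obtain p1 p2 where p12: "p = p1 @ (e, False) # p2" using p(2) by (metis (full_types) split_list)
  have w: "B.awalk r p v" using p(1) by (simp add: B.apath_def)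
  then have p1: "B.awalk r p1 (head G e)" and e: "e \<in> arcs G" unfolding p12 by (auto simp: B.awalk_Cons_iff)
  have "e \<notin> fst ` set p1" using apath_distinct_fst[OF p(1)] by (auto simp: p12)
  moreover obtain q where q: "B.awalk r q (tail G e)" "head G e \<notin> set (B.awalk_verts r q)"
    using oriented_away_in_path[OF away e] by blast
  then have "e \<notin> fst ` set q" using bidirect_ends_in_verts[OF q(1), of e] by auto
  moreover have "e \<in> fst ` set (rev (map (\<lambda>(e, b). (e, \<not> b)) q) @ p1)"
    by (rule undirected_tree_bridge[OF tree e B.awalk_appendI[OF awalk_reverse[OF q(1)] p1]])
  ultimately show False by (auto simp: image_iff split: prod.splits)
qed

lemma awalk_enters:
  "B.awalk u p v \<Longrightarrow> u \<notin> X \<Longrightarrow> v \<in> X \<Longrightarrow>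
    \<exists>a\<in>set p. tail (bidirect G) a \<notin> X \<and> head (bidirect G) a \<in> X"
proof (induction p arbitrary: u)
  case (Cons a p)
  then show ?case by (cases "head (bidirect G) a \<in> X") (auto simp: B.awalk_Cons_iff)
qed (auto simp: B.awalk_Nil_iff)

text \<open>Connects \<open>connected\<close>, which is defined through the support, with walks that
  may traverse arcs backwards.\<close>

lemma reachable_mk_symmetric_bidirect:
  "u \<rightarrow>\<^sup>*\<^bsub>with_proj (mk_symmetric G)\<^esub> v \<longleftrightarrow> u \<rightarrow>\<^sup>*\<^bsub>bidirect G\<^esub> v"
proof -
  have "arcs_ends (bidirect G) = parcs (mk_symmetric G)"
    by (auto simp: arcs_ends_def arc_to_ends_def parcs_mk_symmetric image_iff UNIV_bool Bex_def split: if_splits; metis)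
  then show ?thesis by (simp add: reachable_def)
qed

text \<open>A path from \<open>r\<close> to a vertex of \<open>X\<close> crosses into
  \<open>X\<close>, and it traverses the crossing arc forwards. Singletons \<open>X\<close> give the
  entering arcs.\<close>

lemma arborescence_arb:
  assumes tree: "undirected_tree G" and away: "oriented_away G r" and r: "r \<in> verts G"
  shows "arb (tail G) (head G) (verts G - {r}) (arcs G)"
proof -
  have enter: "\<exists>a\<in>arcs G. head G a \<in> X \<and> tail G a \<notin> X" if X: "X \<subseteq> verts G - {r}" "X \<noteq> {}" for X
  proof -
    obtain x where x: "x \<in> X" using X by auto
    then have "r \<rightarrow>\<^sup>*\<^bsub>with_proj (mk_symmetric G)\<^esub> x"
      using tree r X by (auto simp: undirected_tree_def connected_def strongly_connected_def)
    then obtain p where p: "B.apath r p x" by (auto simp: reachable_mk_symmetric_bidirect B.reachable_apath)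
    then have w: "B.awalk r p x" by (simp add: B.apath_def)
    moreover have "r \<notin> X" using X by auto
    ultimately obtain c where "c \<in> set p" "tail (bidirect G) c \<notin> X" "head (bidirect G) c \<in> X"
      using awalk_enters x by blast
    then obtain a b where ab: "(a, b) \<in> set p" "tail (bidirect G) (a, b) \<notin> X" "head (bidirect G) (a, b) \<in> X"
      by (metis surj_pair)
    have b using arborescence_path_forward[OF tree away p ab(1)] .
    moreover have "a \<in> arcs G" using w ab(1) by (auto simp: B.awalk_def)
    ultimately show ?thesis using ab(2,3) by auto
  qed
  have "\<exists>a\<in>arcs G. head G a = w" if "w \<in> verts G - {r}" for w using enter[of "{w}"] that by auto
  moreover have "inj_on (head G) (arcs G)"
    by (rule inj_onI) (rule arborescence_unique_in_arc[OF tree away])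
  moreover have "head G a \<in> verts G - {r}" if a: "a \<in> arcs G" for a
  proof -
    obtain p where "B.awalk r p (tail G a)" "head G a \<notin> set (B.awalk_verts r p)"
      using oriented_away_in_path[OF away a] by blast
    then have "head G a \<noteq> r" using B.hd_in_awalk_verts by metis
    then show ?thesis using a by simp
  qed
  ultimately show ?thesis using enter by (auto simp: arb_def)
qed

lemma arb_reach:
  assumes arb: "arb (tail G) (head G) (verts G - {r}) (arcs G)" and r: "r \<in> verts G" and x: "x \<in> verts G"
  shows "\<exists>q. B.apath r (map (\<lambda>e. (e, True)) q) x"
proof (rule ccontr)
  let ?P = "\<lambda>x. \<exists>q. B.apath r (map (\<lambda>e. (e, True)) q) x"
  assume nx: "\<not> ?P x"
  have "B.apath r [] r" using r by (simp add: B.apath_Nil_iff)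
  then have pr: "?P r" by (metis list.map(1))
  \<comment> \<open>The vertices not reached by a forward path. An arc entering \<open>X\<close>
    would extend a path to its head, or the head is already on that path and a prefix
    suffices.\<close>
  define X where "X = {x \<in> verts G. \<not> ?P x}"
  have "X \<subseteq> verts G - {r}" "X \<noteq> {}" using pr nx x by (auto simp: X_def)
  then obtain a where a: "a \<in> arcs G" "head G a \<in> X" "tail G a \<notin> X" using arb_entering[OF arb] by blast
  then obtain q where q: "B.apath r (map (\<lambda>e. (e, True)) q) (tail G a)" by (auto simp: X_def)
  let ?q = "map (\<lambda>e. (e, True)) q"
  have w: "B.awalk r ?q (tail G a)" using q by (simp add: B.apath_def)
  have "?P (head G a)"
  proof (cases "head G a \<in> set (B.awalk_verts r ?q)")
    case True
    then obtain q1 q2 where q12: "?q = q1 @ q2" "B.awalk r q1 (head G a)"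
      using B.awalk_decomp[OF w] by blast
    then have "B.apath r q1 (head G a)" using q by (auto simp: B.apath_append_iff)
    then show ?thesis using q12(1) by (auto simp: map_eq_append_conv)
  next
    case False
    have e1: "B.awalk (tail G a) [(a, True)] (head G a)" using a(1) by (auto simp: B.awalk_simps)
    have w2: "B.awalk r (?q @ [(a, True)]) (head G a)" by (rule B.awalk_appendI[OF w e1])
    have "B.awalk_verts r (?q @ [(a, True)]) = B.awalk_verts r ?q @ [head G a]"
      using B.awalk_verts_append[OF w2] by simp
    then have "B.apath r (?q @ [(a, True)]) (head G a)" using w2 q False by (auto simp: B.apath_def)
    then have "B.apath r (map (\<lambda>e. (e, True)) (q @ [a])) (head G a)" by simp
    then show ?thesis by blast
  qed
  then show False using a(2) by (simp add: X_def)
qed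

text \<open>A forward path to the head of \<open>e\<close> must end with an arc entering it, and the
  only such arc is \<open>e\<close>.\<close>

lemma arb_oriented_away:
  assumes arb: "arb (tail G) (head G) (verts G - {r}) (arcs G)" and r: "r \<in> verts G"
  shows "oriented_away G r"
  unfolding oriented_away_def
proof
  fix e assume e: "e \<in> arcs G"
  have he: "head G e \<in> verts G" "head G e \<noteq> r" using arb_head[OF arb e] by auto
  obtain q where q: "B.apath r (map (\<lambda>e. (e, True)) q) (head G e)" using arb_reach[OF arb r he(1)] by blast
  then have "q \<noteq> []" using he(2) by (auto simp: B.apath_Nil_iff)
  then obtain q0 f where f: "q = q0 @ [f]" by (metis rev_exhaust)
  have "B.awalk r (map (\<lambda>e. (e, True)) q) (head G e)" using q by (simp add: B.apath_def)
  then have "f \<in> arcs G" "head G f = head G e" unfolding f by (auto simp: B.awalk_simps)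
  then have "f = e" using arb_unique[OF arb] e by blast
  then show "\<exists>p. B.apath r (p @ [(e, True)]) (head G e)" using q by (auto simp: f)
qed

lemma arb_connected:
  assumes arb: "arb (tail G) (head G) (verts G - {r}) (arcs G)" and r: "r \<in> verts G"
  shows "connected G"
  unfolding connected_def
proof (rule strongly_connectedI)
  show "verts (with_proj (mk_symmetric G)) \<noteq> {}" using r by auto
  fix u v assume "u \<in> verts (with_proj (mk_symmetric G))" "v \<in> verts (with_proj (mk_symmetric G))"
  then obtain p q where "B.awalk r p u" "B.awalk r q v"
    using arb_reach[OF arb r, of u] arb_reach[OF arb r, of v] by (auto simp: B.apath_def)
  then have "B.awalk u (rev (map (\<lambda>(e, b). (e, \<not> b)) p) @ q) v"
    by (intro B.awalk_appendI[OF awalk_reverse])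
  then show "u \<rightarrow>\<^sup>*\<^bsub>with_proj (mk_symmetric G)\<^esub> v"
    unfolding reachable_mk_symmetric_bidirect by (rule B.reachable_awalkI)
qed

text \<open>A cycle has as many arcs as vertices. Since heads are distinct, every vertex on it is
  entered by an arc of the cycle and by no other arc, so its vertex set cannot be entered from
  outside.\<close>

lemma arb_acyclic:
  assumes arb: "arb (tail G) (head G) W (arcs G)"
  shows "\<not> undirected_cycle G p"
proof
  assume "undirected_cycle G p"
  then obtain u where u: "B.awalk u p u" "distinct (tl (B.awalk_verts u p))" "p \<noteq> []" "distinct (map fst p)"
    by (auto simp: undirected_cycle_def B.cycle_def)
  define A where "A = fst ` set p"
  \<comment> \<open>The closed walk lists its base vertex at both ends; \<open>tl\<close> drops one
    copy, so that counting is exact.\<close>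
  define X where "X = set (tl (B.awalk_verts u p))"
  have AX: "card A = length p" "card X = length p"
    using u(2,4) distinct_card[OF u(4)] distinct_card[OF u(2)] B.length_awalk_verts[of u p]
    by (auto simp: A_def X_def)
  obtain ws where ws: "B.awalk_verts u p = u # ws" using B.awhd_of_awalk[OF u(1)] B.awalk_verts_non_Nil
    by (metis list.exhaust_sel)
  have "ws \<noteq> []" using B.length_awalk_verts[of u p] u(3) ws by auto
  then have "u \<in> set ws" using B.awlast_of_awalk[OF u(1)] ws by (metis NOMATCH_def last.simps last_in_set)
  then have X: "set (B.awalk_verts u p) = X" by (auto simp: X_def ws)
  have A: "a \<in> arcs G" "tail G a \<in> X" "head G a \<in> X" if aA: "a \<in> A" for a
  proof -
    obtain b where b: "(a, b) \<in> set p" using aA by (auto simp: A_def)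
    show "tail G a \<in> X" "head G a \<in> X" using bidirect_ends_in_verts[OF u(1) b] X by auto
    show "a \<in> arcs G" using u(1) b by (auto simp: B.awalk_def)
  qed
  have inj: "inj_on (head G) A" using arb_unique[OF arb] A(1) by (auto intro!: inj_onI)
  have hX: "head G ` A = X"
    by (rule card_subset_eq) (use A(3) AX card_image[OF inj] in \<open>auto simp: X_def\<close>)
  have "X \<subseteq> W" using arb_head[OF arb] A(1) unfolding hX[symmetric] by auto
  moreover have "X \<noteq> {}" using AX u(3) by auto
  ultimately obtain a where a: "a \<in> arcs G" "head G a \<in> X" "tail G a \<notin> X" using arb_entering[OF arb] by blast
  then obtain b where "b \<in> A" "head G b = head G a" using hX by (metis imageE)
  then show False using arb_unique[OF arb a(1) A(1)] a(3) A(2) by metis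
qed

end

lemma arborescence_iff_arb:
  assumes "wf_digraph G" "r \<in> verts G"
  shows "arborescence G r T \<longleftrightarrow> T \<in> arbs (tail G) (head G) (verts G - {r}) (arcs G)"
proof -
  interpret G: wf_digraph G by fact
  let ?H = "G\<lparr>arcs := T\<rparr>"
  have sp: "spanning ?H G \<longleftrightarrow> T \<subseteq> arcs G"
    using assms(1) by (auto simp: spanning_def subgraph_def compatible_def wf_digraph_def)
  show ?thesis
  proof (cases "T \<subseteq> arcs G")
    case True
    then interpret H: wf_digraph ?H by unfold_locales auto
    have "undirected_tree ?H \<and> oriented_away ?H r \<longleftrightarrow> arb (tail G) (head G) (verts G - {r}) T"
    proof
      assume "undirected_tree ?H \<and> oriented_away ?H r"
      then show "arb (tail G) (head G) (verts G - {r}) T" using H.arborescence_arb[of r] assms(2) by simp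
    next
      assume "arb (tail G) (head G) (verts G - {r}) T"
      then have "arb (tail ?H) (head ?H) (verts ?H - {r}) (arcs ?H)" "r \<in> verts ?H" using assms(2) by auto
      then show "undirected_tree ?H \<and> oriented_away ?H r"
        using H.arb_connected H.arb_acyclic H.arb_oriented_away by (auto simp: undirected_tree_def)
    qed
    then show ?thesis using True sp assms(2) by (simp add: arborescence_def arbs_def)
  next
    case False
    then show ?thesis using sp by (simp add: arborescence_def arbs_def)
  qed
qed

section \<open>Transfer to the flip graph\<close>

lemma vwalk_arcs_successively:
  "successively P xs \<longleftrightarrow> (\<forall>(x, y)\<in>set (vwalk_arcs xs). P x y)"
  by (induction xs rule: vwalk_arcs.induct) auto

lemma vwalk_arcs_in_set: "(x, y) \<in> set (vwalk_arcs xs) \<Longrightarrow> x \<in> set xs \<and> y \<in> set xs"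
  by (induction xs rule: vwalk_arcs.induct) auto

lemma clique_support_semicomplete:
  assumes "fin_digraph G" "clique (support (pre_digraph.del_vert G r))"
  shows "semicomplete (tail G) (head G) (verts G - {r}) (arcs G)"
proof -
  interpret fin_digraph G by fact
  have p: "parcs (mk_symmetric (del_vert r)) = {(u, v). (u, v) \<in> (verts G - {r}) \<times> (verts G - {r}) \<and> u \<noteq> v}"
    using assms(2) unfolding clique_def complete_digraph_pair_def by (auto simp: verts_del_vert)
  have "\<exists>a\<in>arcs G. tail G a = x \<and> head G a = y \<or> tail G a = y \<and> head G a = x"
    if "x \<in> verts G - {r}" "y \<in> verts G - {r}" "x \<noteq> y" for x y
  proof -
    have "(x, y) \<in> parcs (mk_symmetric (del_vert r))" using that by (simp add: p)
    then show ?thesis by (auto simp: parcs_mk_symmetric del_vert_simps)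
  qed
  then show ?thesis by (simp add: semicomplete_def)
qed

theorem theorem14:
  fixes G :: "('a, 'b) pre_digraph" and r :: 'a
  assumes "fin_digraph G" and "loopfree_digraph G"
    and "r \<in> verts G"
    and "clique (support (pre_digraph.del_vert G r))"
  shows "pverts (flip_graph G r) = {} \<or> (\<exists>p. hamiltonian_path (with_proj (flip_graph G r)) p)"
proof (rule disjCI)
  assume "\<not> (\<exists>p. hamiltonian_path (with_proj (flip_graph G r)) p)"
  interpret fin_digraph G by fact
  let ?A = "arbs (tail G) (head G) (verts G - {r}) (arcs G)"
  have A: "{T. arborescence G r T} = ?A"
    using arborescence_iff_arb[OF wf_digraph_axioms assms(3)] by auto
  have "hamiltonian_path (with_proj (flip_graph G r)) xs" if "flip_path ?A xs" for xs
    using that vwalk_arcs_successively[of arc_flip xs] vwalk_arcs_in_set[of _ _ xs]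
    unfolding hamiltonian_path_def vpath_def vwalk_def flip_path_def flip_graph_def A[symmetric] by auto
  moreover have "\<exists>xs. flip_path ?A xs" if "?A \<noteq> {}"
    using semicomplete_traceable[OF clique_support_semicomplete[OF assms(1,4)]] that
    unfolding traceable_def by blast
  ultimately show "pverts (flip_graph G r) = {}"
    using \<open>\<not> _\<close> A by (auto simp: flip_graph_def)
qed

end
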